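(* For every integer $n\ge 1$, $$\mathrm{pf}_n(213,312)=\sum_{k=0}^{n-1}\sum_{i=0}^{k}\binom{n-1}{i}\cdot\frac{(k+1)\binom{2n-2-k}{n-1-k}}{n}.$$
   Context: A Dyck path of semilength $n$ is a lattice path from $(0,0)$ to $(n,n)$ consisting of $n$ north steps $N=(0,1)$ and $n$ east steps $E=(1,0)$ that never goes below the line $y=x$. A parking function of size $n$ is a Dyck path of semilength $n$ whose $n$ north steps are labeled bijectively by $\{1,\dots,n\}$ so that whenever two north steps are consecutive in the path (one immediately following the other), the label of the later one is larger. For a parking function $p$ of size $n$, $\phi(p)$ is the permutation of $\{1,\dots,n\}$ (in one-line notation) obtained by reading the labels of the north steps in the order they occur along the path. A permutation $\pi$ of $\{1,\dots,n\}$ contains a permutation $\rho$ of $\{1,\dots,m\}$ if there are indices $1\le i_1<\cdots<i_m\le n$ such that $\pi_{i_a}\le\pi_{i_b}$ if and only if $\rho_a\le\rho_b$; otherwise $\pi$ avoids $\rho$. For permutations $\rho_1,\dots,\rho_r$, $\mathrm{pf}_n(\rho_1,\dots,\rho_r)$ denotes the number of parking functions $p$ of size $n$ such that $\phi(p)$ avoids each of $\rho_1,\dots,\rho_r$. *)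

theory Defs
  imports Complex_Main
begin

datatype step = North | East

text \<open>The point \<open>(x, y)\<close> reached from the origin after performing all steps of a path.\<close>

definition endpoint :: "step list \<Rightarrow> nat \<times> nat" where
  "endpoint w = (count_list w East, count_list w North)"

definition dyck_path :: "nat \<Rightarrow> step list \<Rightarrow> bool" where
  "dyck_path n w \<longleftrightarrow>
     endpoint w = (n, n) \<and>
     (\<forall>k\<le>length w. fst (endpoint (take k w)) \<le> snd (endpoint (take k w)))"

text \<open>A path whose north steps carry labels is a list of labelled steps.\<close>

datatype lstep = LNorth nat | LEast

fun forget_label :: "lstep \<Rightarrow> step" where
  "forget_label (LNorth a) = North"
| "forget_label LEast = East"

fun reading_word :: "lstep list \<Rightarrow> nat list" where
  "reading_word [] = []"
| "reading_word (LNorth a # p) = a # reading_word p"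
| "reading_word (LEast # p) = reading_word p"

text \<open>One-line notation: position \<open>i\<close> of the list (counted from 0) holds the image of \<open>i + 1\<close>.\<close>

definition is_permutation :: "nat \<Rightarrow> nat list \<Rightarrow> bool" where
  "is_permutation n xs \<longleftrightarrow> distinct xs \<and> set xs = {1..n}"

text \<open>As \<open>reading_word\<close> lists the labels of all north steps, the second conjunct says that the
  labelling is a bijection from the north steps to \<open>{1..n}\<close>.\<close>

definition parking_function :: "nat \<Rightarrow> lstep list \<Rightarrow> bool" where
  "parking_function n p \<longleftrightarrow>
     dyck_path n (map forget_label p) \<and>
     is_permutation n (reading_word p) \<and>
     (\<forall>i a b. Suc i < length p \<longrightarrow> p ! i = LNorth a \<longrightarrow> p ! Suc i = LNorth b \<longrightarrow> a < b)"

definition contains_pattern :: "nat list \<Rightarrow> nat list \<Rightarrow> bool" where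
  "contains_pattern xs rs \<longleftrightarrow>
     (\<exists>f. strict_mono_on {..<length rs} f \<and> f ` {..<length rs} \<subseteq> {..<length xs} \<and>
          (\<forall>a<length rs. \<forall>b<length rs. xs ! f a \<le> xs ! f b \<longleftrightarrow> rs ! a \<le> rs ! b))"

abbreviation avoids :: "nat list \<Rightarrow> nat list \<Rightarrow> bool" where
  "avoids xs rs \<equiv> \<not> contains_pattern xs rs"

definition pf :: "nat \<Rightarrow> nat list set \<Rightarrow> nat" where
  "pf n R = card {p. parking_function n p \<and> (\<forall>rs\<in>R. avoids (reading_word p) rs)}"

text \<open>The set counted by \<open>pf\<close> is finite, so its cardinality is meaningful.\<close>

lemma set_subset_labels: "set p \<subseteq> insert LEast (LNorth ` set (reading_word p))"
  by (induction p rule: reading_word.induct) auto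

lemma length_eq_counts: "length w = count_list w East + count_list w North"
proof (induction w)
  case (Cons s w)
  then show ?case by (cases s) auto
qed simp

lemma finite_parking_functions: "finite {p. parking_function n p}"
proof (rule finite_subset)
  show "{p. parking_function n p} \<subseteq>
      {p. set p \<subseteq> insert LEast (LNorth ` {1..n}) \<and> length p = 2 * n}"
  proof clarify
    fix p assume p: "parking_function n p"
    then have "set p \<subseteq> insert LEast (LNorth ` {1..n})"
      using set_subset_labels[of p] by (simp add: parking_function_def is_permutation_def)
    moreover have "length p = 2 * n"
      using p length_eq_counts[of "map forget_label p"]
      by (simp add: parking_function_def dyck_path_def endpoint_def)
    ultimately show "set p \<subseteq> insert LEast (LNorth ` {1..n}) \<and> length p = 2 * n" ..
  qed
  show "finite {p. set p \<subseteq> insert LEast (LNorth ` {1..n}) \<and> length p = 2 * n}"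
    using finite_lists_length_eq[of "insert LEast (LNorth ` {1..n})"] by simp
qed

end

(* A permutation of {1..n} avoids 213 and 312 iff it increases up to n and decreases afterwards, so
   it is determined by the set D of entries after n. In a parking function with this reading word
   each of the last card D + 1 north steps is directly followed by an east step; deleting these
   east steps leaves an unrestricted ballot path from (0,0) to (n - 1 - card D, n). Decomposing the
   resulting ballot number as ballot m n = ballot 0 (n - 1) + ... + ballot m (n - 1) and exchanging
   the summations yields the formula. *)

theory Submission
  imports Defs
begin

section \<open>Ballot numbers\<close>

text \<open>Intended as the number of lattice paths from (0,0) to (m, n) that stay weakly above the
  diagonal, split by their last step. The \<open>else\<close> branch covers endpoints strictly below
  the diagonal.\<close>

fun ballot :: "nat \<Rightarrow> nat \<Rightarrow> nat" where
  "ballot 0 n = 1"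
| "ballot (Suc m) 0 = 0"
| "ballot (Suc m) (Suc n) = (if m \<le> n then ballot m (Suc n) + ballot (Suc m) n else 0)"

text \<open>The added binomial is the number of paths that cross the diagonal, as in the reflection
  principle; the proof itself only uses Pascal's rule. The range includes m = n + 1, where the
  ballot number is 0 and the two binomials agree by symmetry, because the recursion calls
  \<open>ballot (Suc m) n\<close> also when m = n.\<close>

lemma ballot_plus_choose:
  "m \<le> Suc n \<Longrightarrow> ballot m n + ((n + m) choose Suc n) = (n + m) choose n"
proof (induction m n rule: ballot.induct)
  case (2 m)
  then show ?case by simp
next
  case (3 m n)
  show ?case
  proof (cases "m \<le> n")
    case True
    then show ?thesis using 3 by simp
  next
    case False
    then have "m = Suc n" using 3 by simp
    then show ?thesis
      using binomial_symmetric[of "Suc n" "Suc n + Suc m"] by simp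
  qed
qed simp

lemma ballot_closed_form:
  assumes "m \<le> n"
  shows "real (ballot m n) = real (Suc n - m) * real ((n + m) choose m) / real (Suc n)"
proof -
  have "Suc n * ((n + m) choose Suc n) = m * ((n + m) choose n)"
    using binomial_absorption[of n "n + m"] binomial_absorb_comp[of "n + m" n] by simp
  then have "real (Suc n) * real ((n + m) choose Suc n) = real m * real ((n + m) choose n)"
    by (metis of_nat_mult)
  moreover have "real (ballot m n) + real ((n + m) choose Suc n) = real ((n + m) choose n)"
    using ballot_plus_choose[of m n] assms by (metis le_SucI of_nat_add)
  moreover have "(n + m) choose n = (n + m) choose m"
    using binomial_symmetric[of n "n + m"] by simp
  \<comment> \<open>To be read with N = n + 1, M = m, x the ballot number and y, z the two
    binomials: N x = N z - N y = (N - M) z.\<close>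
  moreover have "N * x = (N - M) * z" if "N * y = M * z" "x + y = z" for N M x y z :: real
    using that by (auto simp: algebra_simps)
  moreover have "real (Suc n - m) = real (Suc n) - real m"
    using assms by simp
  ultimately have "real (Suc n) * real (ballot m n) = real (Suc n - m) * real ((n + m) choose m)"
    by metis
  then show ?thesis
    by (simp add: field_simps)
qed

lemma ballot_eq_0: "n < m \<Longrightarrow> ballot m n = 0"
  by (cases "(m, n)" rule: ballot.cases) auto

text \<open>Classifies paths by the abscissa j of their last north step; only east steps come after
  it.\<close>

lemma ballot_eq_sum: "m \<le> n \<Longrightarrow> ballot m (Suc n) = (\<Sum>j\<le>m. ballot j n)"
  by (induction m) auto

section \<open>Prefixes of parking functions\<close>

text \<open>Only the conditions that are inherited by initial segments are kept. The endpoint and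
  the bijectivity of the labels are left out, so that paths can be built step by step.\<close>

definition valid_prefix :: "lstep list \<Rightarrow> bool" where
  "valid_prefix p \<longleftrightarrow>
     (\<forall>k\<le>length p. fst (endpoint (take k (map forget_label p)))
        \<le> snd (endpoint (take k (map forget_label p)))) \<and>
     (\<forall>i a b. Suc i < length p \<longrightarrow> p ! i = LNorth a \<longrightarrow> p ! Suc i = LNorth b \<longrightarrow> a < b)"

lemma valid_prefix_Nil [simp]: "valid_prefix []"
  by (simp add: valid_prefix_def endpoint_def)

lemma count_forget_East: "count_list (map forget_label p) East = count_list p LEast"
proof (induction p)
  case (Cons s p)
  then show ?case by (cases s) auto
qed simp

lemma count_forget_North: "count_list (map forget_label p) North = length (reading_word p)"
  by (induction p rule: reading_word.induct) auto

lemma reading_word_append: "reading_word (p @ q) = reading_word p @ reading_word q"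
  by (induction p rule: reading_word.induct) auto

lemma endpoint_forget_label:
  "endpoint (map forget_label p) = (count_list p LEast, length (reading_word p))"
  by (simp add: endpoint_def count_forget_East count_forget_North)

lemma parking_function_iff:
  "parking_function n p \<longleftrightarrow>
     valid_prefix p \<and> is_permutation n (reading_word p) \<and> count_list p LEast = n"
proof -
  have "length (reading_word p) = n" if "is_permutation n (reading_word p)"
    using that distinct_card[of "reading_word p"] by (simp add: is_permutation_def)
  then show ?thesis
    by (auto simp: parking_function_def dyck_path_def valid_prefix_def endpoint_forget_label)
qed

text \<open>Appending a step adds one new point of the path and one new pair of adjacent steps; all
  other conditions already concern \<open>q\<close>.\<close>

lemma valid_prefix_snoc:
  "valid_prefix (q @ [s]) \<longleftrightarrow> valid_prefix q \<and>
     count_list (q @ [s]) LEast \<le> length (reading_word (q @ [s])) \<and>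
     (\<forall>a b. q \<noteq> [] \<longrightarrow> last q = LNorth a \<longrightarrow> s = LNorth b \<longrightarrow> a < b)"
proof -
  have "(\<forall>k\<le>length (q @ [s]). fst (endpoint (take k (map forget_label (q @ [s]))))
        \<le> snd (endpoint (take k (map forget_label (q @ [s]))))) \<longleftrightarrow>
      (\<forall>k\<le>length q. fst (endpoint (take k (map forget_label q)))
        \<le> snd (endpoint (take k (map forget_label q)))) \<and>
      count_list (q @ [s]) LEast \<le> length (reading_word (q @ [s]))"
    (is "?L \<longleftrightarrow> ?R")
  proof -
    have "?L \<longleftrightarrow> (\<forall>k\<le>length q. fst (endpoint (take k (map forget_label q)))
          \<le> snd (endpoint (take k (map forget_label q)))) \<and>
        fst (endpoint (map forget_label (q @ [s]))) \<le> snd (endpoint (map forget_label (q @ [s])))"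
      by (auto simp: le_Suc_eq)
    then show ?thesis unfolding endpoint_forget_label by simp
  qed
  moreover have "(\<forall>i a b. Suc i < length (q @ [s]) \<longrightarrow> (q @ [s]) ! i = LNorth a \<longrightarrow>
        (q @ [s]) ! Suc i = LNorth b \<longrightarrow> a < b) \<longleftrightarrow>
      (\<forall>i a b. Suc i < length q \<longrightarrow> q ! i = LNorth a \<longrightarrow> q ! Suc i = LNorth b \<longrightarrow> a < b) \<and>
      (\<forall>a b. q \<noteq> [] \<longrightarrow> last q = LNorth a \<longrightarrow> s = LNorth b \<longrightarrow> a < b)"
    (is "?L \<longleftrightarrow> ?R")
  proof
    assume L: ?L
    show ?R
    proof (intro conjI allI impI)
      fix i a b assume "Suc i < length q" "q ! i = LNorth a" "q ! Suc i = LNorth b"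
      then show "a < b" using L[rule_format, of i a b] by (simp add: nth_append)
    next
      fix a b assume "q \<noteq> []" "last q = LNorth a" "s = LNorth b"
      then show "a < b" using L[rule_format, of "length q - 1" a b]
        by (simp add: nth_append last_conv_nth)
    qed
  next
    assume R: ?R
    show ?L
    proof (intro allI impI)
      fix i a b
      assume *: "Suc i < length (q @ [s])" "(q @ [s]) ! i = LNorth a" "(q @ [s]) ! Suc i = LNorth b"
      show "a < b"
      proof (cases "Suc i < length q")
        case True
        then show ?thesis using R * by (auto simp: nth_append)
      next
        case False
        then have "i = length q - 1" "q \<noteq> []" "Suc i = length q" using * by auto
        then show ?thesis using R * by (auto simp: nth_append last_conv_nth)
      qed
    qed
  qed
  ultimately show ?thesis
    unfolding valid_prefix_def by blast
qed

lemma valid_prefix_count_le: "valid_prefix p \<Longrightarrow> count_list p LEast \<le> length (reading_word p)"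
  by (cases p rule: rev_cases) (auto simp: valid_prefix_snoc)

section \<open>Recursion for prefixes with a given reading word\<close>

text \<open>The word need not be a permutation, which permits induction on it from the
  right.\<close>

definition prefixes :: "nat \<Rightarrow> nat list \<Rightarrow> lstep list set" where
  "prefixes x ls = {p. valid_prefix p \<and> reading_word p = ls \<and> count_list p LEast = x}"

lemma prefixes_empty: "length ls < x \<Longrightarrow> prefixes x ls = {}"
  using valid_prefix_count_le by (fastforce simp: prefixes_def)

lemma prefixes_Nil: "prefixes x [] = (if x = 0 then {[]} else {})"
proof -
  have "p = []" if "reading_word p = []" "count_list p LEast = 0" for p
    using that by (cases p rule: reading_word.cases) auto
  then show ?thesis
    using prefixes_empty[of "[]" x] by (auto simp: prefixes_def)
qed

definition may_follow :: "nat \<Rightarrow> lstep list \<Rightarrow> bool" where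
  "may_follow a q \<longleftrightarrow> (\<forall>b. q \<noteq> [] \<longrightarrow> last q = LNorth b \<longrightarrow> b < a)"

text \<open>A final east step leaves the reading word unchanged, while a final north step must carry
  its last letter. The upper bound on \<open>x\<close> is the diagonal condition at the endpoint of
  the path; in the second set it follows from the validity of \<open>q\<close>.\<close>

lemma prefixes_snoc:
  "prefixes x (ls @ [a]) =
     (if 0 < x \<and> x \<le> Suc (length ls) then (\<lambda>q. q @ [LEast]) ` prefixes (x - 1) (ls @ [a]) else {}) \<union>
     (\<lambda>q. q @ [LNorth a]) ` {q \<in> prefixes x ls. may_follow a q}" (is "_ = ?R")
proof (intro equalityI subsetI)
  fix p assume p: "p \<in> prefixes x (ls @ [a])"
  then have "p \<noteq> []" by (auto simp: prefixes_def)
  then obtain q s where qs: "p = q @ [s]" by (cases p rule: rev_cases) auto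
  show "p \<in> ?R"
  proof (cases s)
    case (LNorth b)
    then show ?thesis
      using p by (auto simp: prefixes_def qs valid_prefix_snoc reading_word_append may_follow_def)
  next
    case LEast
    then show ?thesis
      using p by (auto simp: prefixes_def qs valid_prefix_snoc reading_word_append)
  qed
next
  fix p assume "p \<in> ?R"
  then show "p \<in> prefixes x (ls @ [a])"
    using valid_prefix_count_le
    by (fastforce simp: prefixes_def valid_prefix_snoc reading_word_append may_follow_def
        split: if_splits)
qed

lemma last_reading_word:
  "q \<noteq> [] \<Longrightarrow> last q = LNorth b \<Longrightarrow> reading_word q \<noteq> [] \<and> last (reading_word q) = b"
  by (cases q rule: rev_cases) (auto simp: reading_word_append)

text \<open>If \<open>q\<close> ends in a north step, then its label is the last letter of
  \<open>ls\<close>, so an ascent imposes no restriction.\<close>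

lemma may_follow_ascent:
  assumes "ls \<noteq> [] \<Longrightarrow> last ls < a"
  shows "{q \<in> prefixes x ls. may_follow a q} = prefixes x ls"
  using assms last_reading_word by (auto simp: prefixes_def may_follow_def)

text \<open>A path ending in the north step for the last letter of \<open>ls\<close> cannot be
  continued by \<open>a\<close>, so an east step is forced at its end.\<close>

lemma may_follow_descent:
  assumes "ls \<noteq> []" "a \<le> last ls"
  shows "{q \<in> prefixes x ls. may_follow a q} =
    (if 0 < x \<and> x \<le> length ls then (\<lambda>q. q @ [LEast]) ` prefixes (x - 1) ls else {})"
proof -
  obtain ms b where ls: "ls = ms @ [b]" using assms by (cases ls rule: rev_cases) auto
  show ?thesis
    using assms by (auto simp: ls prefixes_snoc[of x ms b] may_follow_def)
qed

lemma finite_prefixes: "finite (prefixes x ls)"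
proof (induction ls arbitrary: x rule: rev_induct)
  case Nil
  then show ?case by (simp add: prefixes_Nil)
next
  case (snoc a ls)
  show ?case
  \<comment> \<open>Removing a final east step keeps the word and lowers \<open>x\<close>, which
    calls for a second induction inside the one on the word.\<close>
  proof (induction x)
    case 0
    then show ?case using snoc by (simp add: prefixes_snoc[of 0])
  next
    case (Suc x)
    then show ?case using snoc[of "Suc x"] by (subst prefixes_snoc) simp
  qed
qed

lemma inj_snoc: "inj_on (\<lambda>q. q @ [s]) A"
  by (simp add: inj_on_def)

lemma card_prefixes_snoc:
  "card (prefixes x (ls @ [a])) =
     (if 0 < x \<and> x \<le> Suc (length ls) then card (prefixes (x - 1) (ls @ [a])) else 0) +
     card {q \<in> prefixes x ls. may_follow a q}"
  by (subst prefixes_snoc, subst card_Un_disjoint)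
    (auto simp: finite_prefixes card_image[OF inj_snoc])

section \<open>Counting prefixes with increasing and unimodal reading words\<close>

text \<open>Every letter is an ascent, so the labels impose no condition and the recursion on the
  last step is that of \<open>ballot\<close>.\<close>

lemma card_prefixes_increasing:
  "sorted_wrt (<) ls \<Longrightarrow> card (prefixes x ls) = ballot x (length ls)"
proof (induction ls arbitrary: x rule: rev_induct)
  case Nil
  then show ?case by (cases x) (auto simp: prefixes_Nil)
next
  case (snoc a ls)
  have *: "{q \<in> prefixes y ls. may_follow a q} = prefixes y ls" for y
    using snoc.prems by (intro may_follow_ascent) (auto simp: sorted_wrt_append)
  have IH: "card (prefixes y ls) = ballot y (length ls)" for y
    using snoc by (simp add: sorted_wrt_append)
  show ?case
  proof (induction x)
    case 0
    then show ?case by (subst card_prefixes_snoc) (simp add: * IH)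
  next
    case (Suc x)
    then show ?case
      using prefixes_empty[of "ls @ [a]" "Suc x"]
      by (subst card_prefixes_snoc) (auto simp: * IH prefixes_empty ballot_eq_0)
  qed
qed

text \<open>In a descent the two north steps are separated by an east step. Removing the east step
  in front of each of the north steps labelled by \<open>ds\<close> therefore leaves an unrestricted ballot path.\<close>

lemma card_prefixes_unimodal:
  assumes "us \<noteq> []" "sorted_wrt (<) us" "sorted_wrt (>) (last us # ds)"
    and "x < length us + length ds"
  shows "card (prefixes x (us @ ds)) =
    (if length ds \<le> x then ballot (x - length ds) (length us + length ds) else 0)"
  using assms(3,4)
proof (induction ds arbitrary: x rule: rev_induct)
  case Nil
  then show ?case using card_prefixes_increasing assms by simp
next
  case (snoc a ds)
  have sorted: "sorted_wrt (>) (last us # ds)"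
    using snoc.prems by (auto simp: sorted_wrt_append)
  have "a < last (us @ ds)"
    using snoc.prems by (cases ds rule: rev_cases) (auto simp: sorted_wrt_append)
  then have descent: "card {q \<in> prefixes y (us @ ds). may_follow a q} =
      (if 0 < y \<and> y \<le> length us + length ds then card (prefixes (y - 1) (us @ ds)) else 0)" for y
    using assms(1) by (subst may_follow_descent) (auto simp: card_image[OF inj_snoc])
  have "x < length us + length (ds @ [a]) \<Longrightarrow> card (prefixes x ((us @ ds) @ [a])) =
    (if length (ds @ [a]) \<le> x then ballot (x - length (ds @ [a])) (length us + length (ds @ [a])) else 0)"
  proof (induction x)
    case 0
    then show ?case by (subst card_prefixes_snoc) (simp add: descent)
  next
    case (Suc x)
    have IH: "card (prefixes x (us @ ds)) =
        (if length ds \<le> x then ballot (x - length ds) (length us + length ds) else 0)"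
      using snoc.IH[OF sorted, of x] Suc.prems by simp
    \<comment> \<open>The last step is either east, or the north step labelled \<open>a\<close> with
      a forced east step before it; removing these leaves x east steps in both cases. The bound on
      \<open>Suc x\<close> settles both diagonal conditions.\<close>
    have step: "card (prefixes (Suc x) ((us @ ds) @ [a])) =
        card (prefixes x ((us @ ds) @ [a])) + card (prefixes x (us @ ds))"
      using Suc.prems by (subst card_prefixes_snoc) (simp add: descent)
    show ?case
    proof (cases "length (ds @ [a]) \<le> x")
      case True
      \<comment> \<open>With this \<open>m\<close>, \<open>step\<close> becomes the recursion for
        \<open>ballot (Suc m)\<close>.\<close>
      then obtain m where "x = length ds + Suc m"
        by (metis add_Suc_shift le_Suc_ex length_append_singleton)
      then show ?thesis
        unfolding step using IH Suc by simp
    next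
      case False
      \<comment> \<open>At the threshold \<open>x = length ds\<close> the first summand is 0 and the
        second is \<open>ballot 0 _ = 1\<close>; below it both vanish.\<close>
      then show ?thesis
        unfolding step using IH Suc by (cases "x = length ds") auto
    qed
  qed
  then show ?case using snoc.prems by simp
qed

section \<open>Permutations avoiding 213 and 312\<close>

lemma contains_pattern_3:
  "contains_pattern xs [r, s, t] \<longleftrightarrow>
     (\<exists>i j k. i < j \<and> j < k \<and> k < length xs \<and>
       (\<forall>a<3. \<forall>b<3. xs ! ([i, j, k] ! a) \<le> xs ! ([i, j, k] ! b) \<longleftrightarrow> [r, s, t] ! a \<le> [r, s, t] ! b))"
  (is "?L \<longleftrightarrow> ?R")
proof
  assume ?L
  then obtain f where f: "strict_mono_on {..<3::nat} f" "f ` {..<3} \<subseteq> {..<length xs}"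
    "\<forall>a<3. \<forall>b<3. xs ! f a \<le> xs ! f b \<longleftrightarrow> [r, s, t] ! a \<le> [r, s, t] ! b"
    by (auto simp: contains_pattern_def eval_nat_numeral)
  have nth: "[f 0, f 1, f 2] ! a = f a" if "a < 3" for a
    using that by (auto simp: less_Suc_eq numeral_3_eq_3 numeral_2_eq_2)
  have "f 0 < f 1" "f 1 < f 2"
    using f(1) by (auto simp: strict_mono_on_def)
  moreover have "f 2 < length xs"
    using f(2) by (simp add: image_subset_iff)
  ultimately show ?R
    using f(3) nth by (intro exI[of _ "f 0"] exI[of _ "f 1"] exI[of _ "f 2"]) simp
next
  assume ?R
  then obtain i j k where ijk: "i < j" "j < k" "k < length xs"
    "\<forall>a<3. \<forall>b<3. xs ! ([i, j, k] ! a) \<le> xs ! ([i, j, k] ! b) \<longleftrightarrow> [r, s, t] ! a \<le> [r, s, t] ! b"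
    by blast
  show ?L
    unfolding contains_pattern_def
    using ijk
    by (intro exI[of _ "\<lambda>a. [i, j, k] ! a"])
      (auto simp: strict_mono_on_def less_Suc_eq numeral_3_eq_3)
qed

text \<open>Both patterns have their smallest entry in the middle. By distinctness the outer two
  entries of such a valley are ordered one way or the other, which gives 213 or 312.\<close>

lemma avoids_213_312_iff:
  assumes "distinct xs"
  shows "avoids xs [2, 1, 3] \<and> avoids xs [3, 1, 2] \<longleftrightarrow>
    (\<nexists>i j k. i < j \<and> j < k \<and> k < length xs \<and> xs ! j < xs ! i \<and> xs ! j < xs ! k)"
proof -
  have all3: "(\<forall>a<3. P a) \<longleftrightarrow> P 0 \<and> P 1 \<and> P 2" for P :: "nat \<Rightarrow> bool"
    by (auto simp: less_Suc_eq numeral_3_eq_3 numeral_2_eq_2)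
  have "(\<forall>a<3. \<forall>b<3. xs ! ([i, j, k] ! a) \<le> xs ! ([i, j, k] ! b) \<longleftrightarrow> [2, 1, 3::nat] ! a \<le> [2, 1, 3] ! b) \<longleftrightarrow>
      xs ! j < xs ! i \<and> xs ! i < xs ! k" for i j k
    unfolding all3 by (simp add: not_le) linarith
  then have 213: "contains_pattern xs [2, 1, 3] \<longleftrightarrow> (\<exists>i j k. i < j \<and> j < k \<and> k < length xs \<and>
      xs ! j < xs ! i \<and> xs ! i < xs ! k)"
    unfolding contains_pattern_3 by simp
  have "(\<forall>a<3. \<forall>b<3. xs ! ([i, j, k] ! a) \<le> xs ! ([i, j, k] ! b) \<longleftrightarrow> [3, 1, 2::nat] ! a \<le> [3, 1, 2] ! b) \<longleftrightarrow>
      xs ! j < xs ! k \<and> xs ! k < xs ! i" for i j k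
    unfolding all3 by (simp add: not_le) linarith
  then have 312: "contains_pattern xs [3, 1, 2] \<longleftrightarrow> (\<exists>i j k. i < j \<and> j < k \<and> k < length xs \<and>
      xs ! j < xs ! k \<and> xs ! k < xs ! i)"
    unfolding contains_pattern_3 by simp
  have "xs ! i < xs ! k \<or> xs ! k < xs ! i" if "i < j" "j < k" "k < length xs" for i j k
    using that assms by (metis linorder_neq_iff nth_eq_iff_index_eq order.strict_trans)
  then show ?thesis unfolding 213 312 by (meson less_trans)
qed

definition unimodal_word :: "nat \<Rightarrow> nat set \<Rightarrow> nat list" where
  "unimodal_word n D =
     sorted_list_of_set ({1..<n} - D) @ n # rev (sorted_list_of_set D)"

lemma unimodal_word_sorted:
  fixes D :: "nat set"
  assumes "D \<subseteq> {1..<n}"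
  shows "sorted_wrt (<) (sorted_list_of_set ({1..<n} - D) @ [n])"
    and "sorted_wrt (>) (n # rev (sorted_list_of_set D))"
proof -
  have "finite D" by (rule finite_subset[OF assms]) simp
  then show "sorted_wrt (<) (sorted_list_of_set ({1..<n} - D) @ [n])"
    and "sorted_wrt (>) (n # rev (sorted_list_of_set D))"
    using assms by (auto simp: sorted_wrt_append sorted_wrt_rev)
qed

lemma is_permutation_unimodal_word:
  assumes "D \<subseteq> {1..<n}" "1 \<le> n"
  shows "is_permutation n (unimodal_word n D)"
proof -
  have "finite D" by (rule finite_subset[OF assms(1)]) simp
  then show ?thesis using assms by (auto simp: is_permutation_def unimodal_word_def)
qed

text \<open>No position is the bottom of a valley: up to the peak its entry exceeds every earlier
  one, and after the peak it exceeds every later one.\<close>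

lemma avoids_unimodal_word:
  assumes "D \<subseteq> {1..<n}" "1 \<le> n"
  shows "avoids (unimodal_word n D) [2, 1, 3] \<and> avoids (unimodal_word n D) [3, 1, 2]"
proof -
  define us where "us = sorted_list_of_set ({1..<n} - D)"
  define ds where "ds = rev (sorted_list_of_set D)"
  have xs: "unimodal_word n D = us @ n # ds"
    by (simp add: unimodal_word_def us_def ds_def)
  have up: "sorted_wrt (<) (us @ [n])" and down: "sorted_wrt (>) (n # ds)"
    using unimodal_word_sorted[OF assms(1)] by (simp_all add: us_def ds_def)
  have "\<not> (xs ! j < xs ! i \<and> xs ! j < xs ! k)"
    if "i < j" "j < k" "k < length xs" "xs = us @ n # ds" for i j k xs
  proof (cases "j \<le> length us")
    case True
    have "(us @ [n]) ! i < (us @ [n]) ! j"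
      using that True by (intro sorted_wrt_nth_less[OF up]) auto
    moreover have "xs ! i = (us @ [n]) ! i" "xs ! j = (us @ [n]) ! j"
      using that True by (auto simp: nth_append)
    ultimately show ?thesis by simp
  next
    case False
    have "(n # ds) ! (k - length us) < (n # ds) ! (j - length us)"
      using sorted_wrt_nth_less[OF down, of "j - length us" "k - length us"] that False by auto
    moreover have "xs ! k = (n # ds) ! (k - length us)" "xs ! j = (n # ds) ! (j - length us)"
      using that False by (auto simp: nth_append)
    ultimately show ?thesis by simp
  qed
  moreover have "distinct (unimodal_word n D)"
    using is_permutation_unimodal_word[OF assms] by (simp add: is_permutation_def)
  ultimately show ?thesis
    by (subst avoids_213_312_iff) (use xs in blast)+
qed

lemma avoids_imp_unimodal_word:
  assumes "is_permutation n xs" "1 \<le> n" "avoids xs [2, 1, 3]" "avoids xs [3, 1, 2]"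
  shows "\<exists>D\<subseteq>{1..<n}. xs = unimodal_word n D"
proof -
  have dist: "distinct xs" and set_xs: "set xs = {1..n}"
    using assms by (auto simp: is_permutation_def)
  have no_valley: "\<not> (xs ! j < xs ! i \<and> xs ! j < xs ! k)"
    if "i < j" "j < k" "k < length xs" for i j k
    using avoids_213_312_iff[OF dist] assms that by blast
  have "n \<in> set xs" using set_xs assms by simp
  then obtain us ds where xs: "xs = us @ n # ds" by (meson split_list)
  have lt: "a < n" "1 \<le> a" if "a \<in> set us \<union> set ds" for a
  proof -
    have "a \<in> {1..n}" using that set_xs xs by auto
    moreover have "a \<noteq> n" using that dist xs by auto
    ultimately show "a < n" "1 \<le> a" by auto
  qed
  have up: "sorted_wrt (<) us"
    unfolding sorted_wrt_iff_nth_less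
  proof (intro allI impI)
    fix i j assume ij: "i < j" "j < length us"
    have "us ! j < n" using lt ij by simp
    \<comment> \<open>A descent before \<open>n\<close> would be a valley whose right side is
      \<open>n\<close>, at position \<open>length us\<close>.\<close>
    then have "\<not> us ! j < us ! i"
      using no_valley[of i j "length us"] ij xs by (simp add: nth_append)
    moreover have "us ! i \<noteq> us ! j"
      using ij dist xs by (simp add: nth_eq_iff_index_eq)
    ultimately show "us ! i < us ! j" by simp
  qed
  have down: "sorted_wrt (>) ds"
    unfolding sorted_wrt_iff_nth_less
  proof (intro allI impI)
    fix i j assume ij: "i < j" "j < length ds"
    have "ds ! i < n" using lt ij by simp
    \<comment> \<open>Symmetrically, \<open>n\<close> is the left side of a valley arising from an
      ascent after it.\<close>
    then have "\<not> ds ! i < ds ! j"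
      using no_valley[of "length us" "length us + Suc i" "length us + Suc j"] ij xs
      by (simp add: nth_append)
    moreover have "ds ! i \<noteq> ds ! j"
      using ij dist xs by (simp add: nth_eq_iff_index_eq)
    ultimately show "ds ! j < ds ! i" by simp
  qed
  have "set us = {1..<n} - set ds"
  proof -
    have "insert n (set us \<union> set ds) = {1..n}"
      using set_xs xs by auto
    moreover have "set us \<inter> set ds = {}" "n \<notin> set us"
      using dist xs by auto
    moreover have "{1..<n} = {1..n} - {n}" by auto
    moreover have "n \<notin> set ds" using dist xs by auto
    ultimately show ?thesis by blast
  qed
  moreover have "sorted_list_of_set (set us) = us"
    using up by (intro sorted_list_of_set.idem_if_sorted_distinct)
      (auto simp: strict_sorted_iff)
  moreover have "sorted_list_of_set (set (rev ds)) = rev ds"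
  proof (intro sorted_list_of_set.idem_if_sorted_distinct)
    have "sorted_wrt (<) (rev ds)" using down by (simp add: sorted_wrt_rev)
    then show "sorted (rev ds)" "distinct (rev ds)" by (simp_all add: strict_sorted_iff)
  qed
  ultimately have "xs = unimodal_word n (set ds)"
    using xs by (simp add: unimodal_word_def)
  then show ?thesis using lt by (intro exI[of _ "set ds"]) auto
qed

text \<open>Since \<open>n\<close> occurs only once, splitting the word there recovers
  \<open>D\<close> from the right part.\<close>

lemma inj_unimodal_word: "inj_on (unimodal_word n) (Pow {1..<n})"
proof (rule inj_onI)
  fix D E assume DE: "D \<in> Pow {1..<n}" "E \<in> Pow {1..<n}" "unimodal_word n D = unimodal_word n E"
  have fin: "finite D" "finite E" using DE finite_subset by auto
  moreover have "n \<notin> D" "n \<notin> E" using DE by auto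
  ultimately have "rev (sorted_list_of_set D) = rev (sorted_list_of_set E)"
    using DE(3) append_Cons_eq_iff[of n "sorted_list_of_set ({1..<n} - D)"
        "rev (sorted_list_of_set D)" "sorted_list_of_set ({1..<n} - E)"
        "rev (sorted_list_of_set E)"]
    by (simp add: unimodal_word_def)
  then show "D = E" using fin by (metis rev_rev_ident set_sorted_list_of_set)
qed

section \<open>Summing over the reading words\<close>

lemma card_prefixes_unimodal_word:
  assumes "D \<subseteq> {1..<n}" "1 \<le> n"
  shows "card (prefixes n (unimodal_word n D)) = ballot (n - 1 - card D) n"
proof -
  define us where "us = sorted_list_of_set ({1..<n} - D) @ [n]"
  define ds where "ds = rev (sorted_list_of_set D)"
  have fin: "finite D" by (rule finite_subset[OF assms(1)]) simp
  have card: "card D \<le> n - 1" using card_mono[OF _ assms(1)] by simp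
  have len: "length us = n - card D" "length ds = card D"
    using assms fin card by (auto simp: us_def ds_def card_Diff_subset)
  have word: "unimodal_word n D = us @ ds"
    by (simp add: unimodal_word_def us_def ds_def)
  have "length (us @ ds) = n" using len card by simp
  then have len_word: "length (unimodal_word n D) = n" using word by simp
  obtain ls a where ls: "unimodal_word n D = ls @ [a]"
    using len_word assms(2) by (cases "unimodal_word n D" rule: rev_cases) auto
  \<comment> \<open>A path with n east and n north steps must end in an east step, since n - 1 north
    steps do not allow n east steps before a final north step. Deleting it brings the number of east
    steps below the word length, as \<open>card_prefixes_unimodal\<close> demands.\<close>
  have "card (prefixes n (unimodal_word n D)) = card (prefixes (n - 1) (unimodal_word n D))"
    using len_word assms(2) unfolding ls
    by (subst card_prefixes_snoc) (simp add: prefixes_empty)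
  also have "\<dots> = ballot (n - 1 - card D) n"
    unfolding word using unimodal_word_sorted[OF assms(1)] card len assms(2)
    by (subst card_prefixes_unimodal) (auto simp: us_def ds_def)
  finally show ?thesis .
qed

text \<open>The reading word splits the parking functions into disjoint classes indexed by subsets
  \<open>D\<close> of {1..<n}. The size of a class depends only on \<open>card D\<close>, whence the
  binomial coefficient.\<close>

lemma pf_eq_sum_ballot:
  assumes "1 \<le> n"
  shows "pf n {[2, 1, 3], [3, 1, 2]} = (\<Sum>d\<le>n - 1. ((n - 1) choose d) * ballot (n - 1 - d) n)"
proof -
  have "{p. parking_function n p \<and> (\<forall>rs\<in>{[2, 1, 3], [3, 1, 2]}. avoids (reading_word p) rs)} =
      (\<Union>D\<in>Pow {1..<n}. prefixes n (unimodal_word n D))"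
    (is "?L = ?R")
  proof (intro equalityI subsetI)
    fix p assume p: "p \<in> ?L"
    then obtain D where "D \<subseteq> {1..<n}" "reading_word p = unimodal_word n D"
      using avoids_imp_unimodal_word[OF _ assms, of "reading_word p"]
      by (auto simp: parking_function_iff)
    then show "p \<in> ?R"
      using p by (auto simp: parking_function_iff prefixes_def)
  next
    fix p assume "p \<in> ?R"
    then obtain D where "D \<subseteq> {1..<n}" "p \<in> prefixes n (unimodal_word n D)" by blast
    then show "p \<in> ?L"
      using avoids_unimodal_word[OF _ assms, of D] is_permutation_unimodal_word[OF _ assms, of D]
      by (simp add: parking_function_iff prefixes_def)
  qed
  then have "pf n {[2, 1, 3], [3, 1, 2]} = card (\<Union>D\<in>Pow {1..<n}. prefixes n (unimodal_word n D))"
    by (simp add: pf_def)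
  also have "\<dots> = (\<Sum>D\<in>Pow {1..<n}. card (prefixes n (unimodal_word n D)))"
  proof (intro card_UN_disjoint ballI impI)
    fix D E assume "D \<in> Pow {1..<n}" "E \<in> Pow {1..<n}" "D \<noteq> E"
    then have "unimodal_word n D \<noteq> unimodal_word n E"
      using inj_onD[OF inj_unimodal_word] by blast
    then show "prefixes n (unimodal_word n D) \<inter> prefixes n (unimodal_word n E) = {}"
      by (auto simp: prefixes_def)
  qed (simp_all add: finite_prefixes)
  also have "\<dots> = (\<Sum>D\<in>Pow {1..<n}. ballot (n - 1 - card D) n)"
    using card_prefixes_unimodal_word assms by (intro sum.cong) auto
  also have "\<dots> = (\<Sum>d\<le>n - 1. \<Sum>D\<in>{D \<in> Pow {1..<n}. card D = d}. ballot (n - 1 - card D) n)"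
    using card_mono[of "{1..<n}"] by (intro sum.group[symmetric]) auto
  also have "\<dots> = (\<Sum>d\<le>n - 1. ((n - 1) choose d) * ballot (n - 1 - d) n)"
    using n_subsets[of "{1..<n}"] by (intro sum.cong) auto
  finally show ?thesis .
qed

theorem theorem26:
  fixes n :: nat
  assumes "n \<ge> 1"
  shows "real (pf n {[2, 1, 3], [3, 1, 2]}) =
    (\<Sum>k = 0..n - 1. \<Sum>i = 0..k.
       real ((n - 1) choose i) *
       (real (k + 1) * real ((2 * n - 2 - k) choose (n - 1 - k)) / real n))"
proof -
  obtain m where n: "n = Suc m" using assms by (cases n) auto
  have "ballot (m - d) (Suc m) = (\<Sum>k = d..m. ballot (m - k) m)" if "d \<le> m" for d
  proof -
    \<comment> \<open>The substitution k = m - j makes d the lower limit of k, so that the double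
      sum ranges over the triangle d \<le> k \<le> m and can be exchanged.\<close>
    have "(\<Sum>k = d..m. ballot (m - k) m) = (\<Sum>j\<le>m - d. ballot j m)"
      using that
      by (intro sum.reindex_bij_witness[of _ "\<lambda>j. m - j" "\<lambda>k. m - k"]) auto
    then show ?thesis by (simp add: ballot_eq_sum)
  qed
  then have "pf n {[2, 1, 3], [3, 1, 2]} = (\<Sum>d\<le>m. \<Sum>k = d..m. (m choose d) * ballot (m - k) m)"
    using pf_eq_sum_ballot[OF assms] by (simp add: n sum_distrib_left)
  also have "\<dots> = (\<Sum>k = 0..m. \<Sum>d = 0..k. (m choose d) * ballot (m - k) m)"
    unfolding sum.Sigma[OF finite_atMost ballI[OF finite_atLeastAtMost]]
      sum.Sigma[OF finite_atLeastAtMost ballI[OF finite_atLeastAtMost]]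
    by (intro sum.reindex_bij_witness[of _ "\<lambda>(k, d). (d, k)" "\<lambda>(d, k). (k, d)"]) auto
  also have "real \<dots> = (\<Sum>k = 0..m. \<Sum>i = 0..k. real (m choose i) * real (ballot (m - k) m))"
    by simp
  also have "\<dots> = (\<Sum>k = 0..n - 1. \<Sum>i = 0..k.
       real ((n - 1) choose i) *
       (real (k + 1) * real ((2 * n - 2 - k) choose (n - 1 - k)) / real n))"
  proof (intro sum.cong refl)
    fix k i assume "k \<in> {0..n - 1}"
    then have k: "k \<le> m" using n by simp
    \<comment> \<open>These match the closed form at \<open>ballot (m - k) m\<close> with the
      required summand; truncated subtraction is harmless because k \<le> m.\<close>
    have "Suc m - (m - k) = k + 1" "m + (m - k) = 2 * n - 2 - k" using k n by auto
    then show "real (m choose i) * real (ballot (m - k) m) = real ((n - 1) choose i) *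
       (real (k + 1) * real ((2 * n - 2 - k) choose (n - 1 - k)) / real n)"
      using ballot_closed_form[of "m - k" m] n by simp
  qed (use n in simp)
  finally show ?thesis .
qed

end
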